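(* Let $\gamma:I\to M\subset G^3$ be a unit speed geodesic curve on a surface $M$ in the Galilean space $G^3$ (that is, $\kappa_g\equiv0$) that is a Salkowski curve. Then the position vectors of the special Smarandache curves of $\gamma$ are $$\alpha^g_{s\,\mathbf{TN}}(x)=\left(1,\ m\int\cos\Big(\int\tau_g dx\Big)dx+\cos\Big(\int\tau_g dx\Big),\ -m\int\sin\Big(\int\tau_g dx\Big)dx-\sin\Big(\int\tau_g dx\Big)\right),$$ $$\alpha^g_{s\,\mathbf{TB}}(x)=\left(1,\ m\int\cos\Big(\int\tau_g dx\Big)dx+\sin\Big(\int\tau_g dx\Big),\ -m\int\sin\Big(\int\tau_g dx\Big)dx+\cos\Big(\int\tau_g dx\Big)\right),$$ $$\alpha^g_{s\,\mathbf{TNB}}(x)=\left(1,\ m\int\cos\Big(\int\tau_g dx\Big)dx+\cos\Big(\int\tau_g dx\Big)+\sin\Big(\int\tau_g dx\Big),\ -m\int\sin\Big(\int\tau_g dx\Big)dx+\cos\Big(\int\tau_g dx\Big)-\sin\Big(\int\tau_g dx\Big)\right),$$ where $m$ is a constant (with $\kappa_n\equiv m$).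
   Context: Galilean space $G^3$ is $\mathbb{R}^3$ with scalar product $v\cdot_G w=v_1w_1$ if $v_1\ne0$ or $w_1\neq 0$, and $v\cdot_G w=v_2w_2+v_3w_3$ if $v_1=w_1=0$; norm $\|v\|_G=\sqrt{|v\cdot_G v|}$; cross product $v\times_G w=(0,\ v_3w_1-v_1w_3,\ v_1w_2-v_2w_1)$. A vector is isotropic if its first component is $0$. A unit speed curve is written $\gamma(x)=(x,y(x),z(x))$, $x\in I\subset\mathbb{R}$; its curvature is $\kappa=\|\gamma''\|_G$ (assumed $>0$), its torsion is $\tau=\det(\gamma',\gamma'',\gamma''')/\kappa^2$, and its Frenet frame is $\mathbf T=\gamma'$, $\mathbf N=\gamma''/\kappa$, $\mathbf B=\mathbf T\times_G\mathbf N=\frac1\kappa(0,-z'',y'')$. For a curve $\gamma$ on a surface $M$, $\mathbf n$ is the unit normal vector field of $M$ along $\gamma$ (the isotropic unit vector field in the direction of $\phi_u\times_G\phi_v$ for a local parametrization $\phi(u,v)$ of $M$), and $\mathbf Q=\mathbf n\times_G\mathbf T$. The geodesic curvature $\kappa_g$, normal curvature $\kappa_n$ and geodesic torsion $\tau_g$ are the functions of $x$ in the Darboux formulas $\mathbf T'=\kappa_g\mathbf Q+\kappa_n\mathbf n$, $\mathbf Q'=\tau_g\mathbf n$, $\mathbf n'=-\tau_g\mathbf Q$. One has $\kappa^2=\kappa_g^2+\kappa_n^2$. A Salkowski curve is a curve with $\kappa$ constant and $\tau$ non-constant. Special Smarandache curves of $\gamma$ (here denoted $\alpha^g_{s}$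 with the corresponding subscript): the $\mathbf{TN}$ curve is $\mathbf T+\mathbf N$, the $\mathbf{TB}$ curve is $\mathbf T+\mathbf B$, the $\mathbf{TNB}$ curve is $\mathbf T+\mathbf N+\mathbf B$. Integral signs denote indefinite integrals.
   Formalization: With Q = n × T the printed formulas hold for no such curve; the proved version replaces ∫τ_g dx by −∫τ_g dx throughout and multiplies the sine and cosine terms coming from N and B by sgn m (equal to 1 when m > 0), since N = sgn(m) n. *)

theory Defs
  imports "HOL-Analysis.Analysis"
begin

section \<open>Galilean space\<close>

definition gdot :: "real^3 \<Rightarrow> real^3 \<Rightarrow> real" where
  "gdot v w = (if v $ 1 \<noteq> 0 \<or> w $ 1 \<noteq> 0 then v $ 1 * w $ 1
               else v $ 2 * w $ 2 + v $ 3 * w $ 3)"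

definition gnorm :: "real^3 \<Rightarrow> real" where
  "gnorm v = sqrt \<bar>gdot v v\<bar>"

definition gcross :: "real^3 \<Rightarrow> real^3 \<Rightarrow> real^3" where
  "gcross v w = vector [0, v $ 3 * w $ 1 - v $ 1 * w $ 3, v $ 1 * w $ 2 - v $ 2 * w $ 1]"

section \<open>Unit speed curves and the Frenet frame\<close>

definition curve_deriv :: "(real \<Rightarrow> real^3) \<Rightarrow> real \<Rightarrow> real^3" where
  "curve_deriv \<gamma> = (\<lambda>x. vector_derivative \<gamma> (at x))"

definition curvature :: "(real \<Rightarrow> real^3) \<Rightarrow> real \<Rightarrow> real" where
  "curvature \<gamma> x = gnorm ((curve_deriv ^^ 2) \<gamma> x)"

definition torsion :: "(real \<Rightarrow> real^3) \<Rightarrow> real \<Rightarrow> real" where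
  "torsion \<gamma> x =
     det (vector [curve_deriv \<gamma> x, (curve_deriv ^^ 2) \<gamma> x, (curve_deriv ^^ 3) \<gamma> x] :: real^3^3)
       / (curvature \<gamma> x)\<^sup>2"

text \<open>Curves are of class \<open>C\<^sup>3\<close>, the regularity needed for the torsion.\<close>

definition unit_speed_curve :: "real set \<Rightarrow> (real \<Rightarrow> real^3) \<Rightarrow> bool" where
  "unit_speed_curve I \<gamma> \<longleftrightarrow>
     open I \<and> is_interval I \<and> I \<noteq> {} \<and>
     (\<forall>x\<in>I. \<gamma> x $ 1 = x) \<and>
     (\<forall>k<3. \<forall>x\<in>I. (curve_deriv ^^ k) \<gamma> differentiable at x) \<and>
     continuous_on I ((curve_deriv ^^ 3) \<gamma>) \<and>
     (\<forall>x\<in>I. curvature \<gamma> x > 0)"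

definition tangent :: "(real \<Rightarrow> real^3) \<Rightarrow> real \<Rightarrow> real^3" where
  "tangent \<gamma> x = curve_deriv \<gamma> x"

definition principal_normal :: "(real \<Rightarrow> real^3) \<Rightarrow> real \<Rightarrow> real^3" where
  "principal_normal \<gamma> x = (1 / curvature \<gamma> x) *\<^sub>R (curve_deriv ^^ 2) \<gamma> x"

definition binormal :: "(real \<Rightarrow> real^3) \<Rightarrow> real \<Rightarrow> real^3" where
  "binormal \<gamma> x = gcross (tangent \<gamma> x) (principal_normal \<gamma> x)"

definition salkowski :: "real set \<Rightarrow> (real \<Rightarrow> real^3) \<Rightarrow> bool" where
  "salkowski I \<gamma> \<longleftrightarrow> curvature \<gamma> constant_on I \<and> \<not> torsion \<gamma> constant_on I"

definition smarandache_TN :: "(real \<Rightarrow> real^3) \<Rightarrow> real \<Rightarrow> real^3" where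
  "smarandache_TN \<gamma> x = tangent \<gamma> x + principal_normal \<gamma> x"

definition smarandache_TB :: "(real \<Rightarrow> real^3) \<Rightarrow> real \<Rightarrow> real^3" where
  "smarandache_TB \<gamma> x = tangent \<gamma> x + binormal \<gamma> x"

definition smarandache_TNB :: "(real \<Rightarrow> real^3) \<Rightarrow> real \<Rightarrow> real^3" where
  "smarandache_TNB \<gamma> x = tangent \<gamma> x + principal_normal \<gamma> x + binormal \<gamma> x"

section \<open>Surfaces and the Darboux frame\<close>

definition partial_u :: "(real \<times> real \<Rightarrow> real^3) \<Rightarrow> real \<times> real \<Rightarrow> real^3" where
  "partial_u \<phi> p = frechet_derivative \<phi> (at p) (1, 0)"

definition partial_v :: "(real \<times> real \<Rightarrow> real^3) \<Rightarrow> real \<times> real \<Rightarrow> real^3" where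
  "partial_v \<phi> p = frechet_derivative \<phi> (at p) (0, 1)"

text \<open>The condition \<open>gcross (partial_u \<phi> p) (partial_v \<phi> p) \<noteq> 0\<close> implies linear independence of the
  partial derivatives and also says that the tangent plane is not the isotropic plane \<open>x = const\<close>;
  this is exactly what makes the isotropic unit normal exist.\<close>

definition local_parametrization ::
    "(real^3) set \<Rightarrow> (real \<times> real) set \<Rightarrow> (real \<times> real \<Rightarrow> real^3) \<Rightarrow> bool" where
  "local_parametrization M U \<phi> \<longleftrightarrow>
     open U \<and> openin (top_of_set M) (\<phi> ` U) \<and> (\<exists>\<psi>. homeomorphism U (\<phi> ` U) \<phi> \<psi>) \<and>
     (\<forall>p\<in>U. \<phi> differentiable at p) \<and>
     continuous_on U (partial_u \<phi>) \<and> continuous_on U (partial_v \<phi>) \<and>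
     (\<forall>p\<in>U. gcross (partial_u \<phi> p) (partial_v \<phi> p) \<noteq> 0)"

definition surface :: "(real^3) set \<Rightarrow> bool" where
  "surface M \<longleftrightarrow> (\<forall>q\<in>M. \<exists>U \<phi>. local_parametrization M U \<phi> \<and> q \<in> \<phi> ` U)"

text \<open>Exchanging the two parameters reverses the normal, so a surface has two unit normals at each
  point; a unit normal field along a curve is a continuous choice of one of them.\<close>

definition unit_normal_along ::
    "(real^3) set \<Rightarrow> real set \<Rightarrow> (real \<Rightarrow> real^3) \<Rightarrow> (real \<Rightarrow> real^3) \<Rightarrow> bool" where
  "unit_normal_along M I \<gamma> n \<longleftrightarrow>
     continuous_on I n \<and>
     (\<forall>x\<in>I. \<exists>U \<phi> p. local_parametrization M U \<phi> \<and> p \<in> U \<and> \<phi> p = \<gamma> x \<and>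
        n x = (1 / gnorm (gcross (partial_u \<phi> p) (partial_v \<phi> p))) *\<^sub>R
                gcross (partial_u \<phi> p) (partial_v \<phi> p))"

definition darboux_Q :: "(real \<Rightarrow> real^3) \<Rightarrow> (real \<Rightarrow> real^3) \<Rightarrow> real \<Rightarrow> real^3" where
  "darboux_Q \<gamma> n x = gcross (n x) (tangent \<gamma> x)"

text \<open>\<open>\<kappa>\<^sub>g\<close>, \<open>\<kappa>\<^sub>n\<close>, \<open>\<tau>\<^sub>g\<close> are the geodesic curvature, normal curvature and geodesic torsion; the
  equations determine them uniquely on \<open>I\<close>. Replacing \<open>n\<close> by \<open>-n\<close> changes the signs of \<open>\<kappa>\<^sub>g\<close> and
  \<open>\<kappa>\<^sub>n\<close> but not of \<open>\<tau>\<^sub>g\<close>.\<close>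

definition darboux_formulas ::
    "real set \<Rightarrow> (real \<Rightarrow> real^3) \<Rightarrow> (real \<Rightarrow> real^3) \<Rightarrow>
     (real \<Rightarrow> real) \<Rightarrow> (real \<Rightarrow> real) \<Rightarrow> (real \<Rightarrow> real) \<Rightarrow> bool" where
  "darboux_formulas I \<gamma> n \<kappa>\<^sub>g \<kappa>\<^sub>n \<tau>\<^sub>g \<longleftrightarrow>
     (\<forall>x\<in>I.
        (tangent \<gamma> has_vector_derivative (\<kappa>\<^sub>g x *\<^sub>R darboux_Q \<gamma> n x + \<kappa>\<^sub>n x *\<^sub>R n x)) (at x) \<and>
        (darboux_Q \<gamma> n has_vector_derivative (\<tau>\<^sub>g x *\<^sub>R n x)) (at x) \<and>
        (n has_vector_derivative (- \<tau>\<^sub>g x *\<^sub>R darboux_Q \<gamma> n x)) (at x))"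

text \<open>The equations \<open>Q' = \<tau>\<^sub>g n\<close>, \<open>n' = -\<tau>\<^sub>g Q\<close> together with the orientation \<open>Q = n \<times> T\<close> make the
  angle \<open>\<Theta>\<close> in \<open>n = (0, cos \<Theta>, - sin \<Theta>)\<close> an antiderivative of \<open>-\<tau>\<^sub>g\<close>, not of \<open>\<tau>\<^sub>g\<close>. Along a
  geodesic with \<open>\<kappa>\<^sub>n = m\<close> constant, the principal normal is \<open>sgn m *\<^sub>R n\<close>.\<close>

end

(* Along a geodesic, T' = \<kappa>\<^sub>n n, so \<bar>\<kappa>\<^sub>n\<bar> is the constant curvature; being continuous
   on an interval, \<kappa>\<^sub>n is a nonzero constant m. Then n = \<gamma>'' / m is of class C^1, so \<tau>\<^sub>g is continuous
   and -\<tau>\<^sub>g has an antiderivative \<Theta>. The Darboux equations for n = (0, a, b) read a' = -\<tau>\<^sub>g b, b' = \<tau>\<^sub>g a,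
   so (a + i b) exp (i \<Theta>) is constant, and for the right constant of integration n = (0, cos \<Theta>, - sin \<Theta>).
   Since the components of T have derivatives 0, m cos \<Theta>, -m sin \<Theta>, the antiderivatives of cos \<Theta> and
   sin \<Theta> can be read off from T, while N = sgn m n and B = T \<times> N. *)
theory Submission
  imports Defs
begin

lemma vec3_eq_iff: "(v :: 'a^3) = w \<longleftrightarrow> v $ 1 = w $ 1 \<and> v $ 2 = w $ 2 \<and> v $ 3 = w $ 3"
  by (simp add: vec_eq_iff forall_3)

lemma has_vector_derivative_vec_nth:
  fixes f :: "real \<Rightarrow> real^'n"
  assumes "(f has_vector_derivative f') F"
  shows "((\<lambda>x. f x $ i) has_real_derivative f' $ i) F"
  using bounded_linear.has_vector_derivative[OF bounded_linear_vec_nth assms, of i]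
  by (simp add: has_real_derivative_iff_has_vector_derivative)

lemma gcross_nth [simp]:
  "gcross v w $ 1 = 0"
  "gcross v w $ 2 = v $ 3 * w $ 1 - v $ 1 * w $ 3"
  "gcross v w $ 3 = v $ 1 * w $ 2 - v $ 2 * w $ 1"
  by (simp_all add: gcross_def)

lemma gnorm_isotropic: "v $ 1 = 0 \<Longrightarrow> gnorm v = sqrt ((v $ 2)\<^sup>2 + (v $ 3)\<^sup>2)"
  by (simp add: gnorm_def gdot_def power2_eq_square)

lemma gnorm_scaleR_isotropic:
  assumes "v $ 1 = 0"
  shows "gnorm (c *\<^sub>R v) = \<bar>c\<bar> * gnorm v"
proof -
  have "gnorm (c *\<^sub>R v) = sqrt (c\<^sup>2 * ((v $ 2)\<^sup>2 + (v $ 3)\<^sup>2))"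
    using assms by (simp add: gnorm_isotropic power_mult_distrib distrib_left)
  then show ?thesis
    using assms by (simp add: gnorm_isotropic real_sqrt_mult)
qed

text \<open>A Galilean cross product is always isotropic, and a local parametrization makes this one
  nonzero, so its Galilean norm is the positive Euclidean norm of the last two components and the
  normalization is genuine.\<close>

lemma unit_normal_isotropic_unit:
  assumes "unit_normal_along M I \<gamma> n" "x \<in> I"
  shows "n x $ 1 = 0" "(n x $ 2)\<^sup>2 + (n x $ 3)\<^sup>2 = 1"
proof -
  obtain w where w: "n x = (1 / gnorm w) *\<^sub>R w" "w $ 1 = 0" "w \<noteq> 0"
    using assms unfolding unit_normal_along_def local_parametrization_def
    by (metis gcross_nth(1))
  have "(gnorm w)\<^sup>2 = (w $ 2)\<^sup>2 + (w $ 3)\<^sup>2"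
    using w(2) by (simp add: gnorm_isotropic)
  moreover have "(w $ 2)\<^sup>2 + (w $ 3)\<^sup>2 \<noteq> 0"
    using w by (simp add: vec3_eq_iff sum_power2_eq_zero_iff)
  ultimately show "(n x $ 2)\<^sup>2 + (n x $ 3)\<^sup>2 = 1"
    by (simp add: w(1) power_divide flip: add_divide_distrib)
  show "n x $ 1 = 0"
    using w by simp
qed

text \<open>The values lie in the finite set \<open>{c, - c}\<close>, and a continuous function with
  finite range on a connected set is constant. This rules out a change of sign of the normal
  curvature.\<close>

lemma continuous_on_abs_const_imp_constant:
  fixes f :: "'a::topological_space \<Rightarrow> real"
  assumes "connected A" "continuous_on A f" "\<And>x. x \<in> A \<Longrightarrow> \<bar>f x\<bar> = c"
  shows "f constant_on A"
proof (rule continuous_finite_range_constant[OF assms(1,2)])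
  have "f ` A \<subseteq> {c, - c}"
    using assms(3) by fastforce
  then show "finite (f ` A)"
    by (rule finite_subset) simp
qed

text \<open>A nonempty open interval, bounded or not, is exactly the set of reals strictly between
  its infimum and supremum in \<open>ereal\<close>, which is the form
  \<open>einterval_antiderivative\<close> expects. Openness gives the strict bounds, the interval
  property the converse.\<close>

lemma continuous_on_open_interval_antiderivative:
  fixes f :: "real \<Rightarrow> real"
  assumes "open I" "is_interval I" "continuous_on I f"
  shows "\<exists>F. \<forall>x\<in>I. (F has_real_derivative f x) (at x)"
proof (cases "I = {}")
  case False
  define a b where "a = (INF x\<in>I. ereal x)" and "b = (SUP x\<in>I. ereal x)"
  have bounds: "a < ereal x \<and> ereal x < b" if x: "x \<in> I" for x
  proof -
    obtain e where "e > 0" "cball x e \<subseteq> I"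
      using assms(1) x by (meson open_contains_cball)
    then have "x - e \<in> I" "x + e \<in> I"
      by (auto simp: subset_iff dist_real_def)
    then have "a \<le> ereal (x - e)" "ereal (x + e) \<le> b"
      unfolding a_def b_def by (auto intro: INF_lower SUP_upper)
    moreover have "ereal (x - e) < ereal x" "ereal x < ereal (x + e)"
      using \<open>e > 0\<close> by auto
    ultimately show ?thesis
      by (meson le_less_trans less_le_trans)
  qed
  have inside: "x \<in> I" if x: "a < ereal x" "ereal x < b" for x
  proof -
    obtain y z where "y \<in> I" "y < x" "z \<in> I" "x < z"
      using x by (auto simp: a_def b_def INF_less_iff less_SUP_iff)
    then show ?thesis
      using assms(2) by (meson is_interval_1 less_imp_le)
  qed
  have "a < b"
    using False bounds by (meson all_not_in_conv less_trans)
  moreover have "isCont f x" if "a < ereal x" "ereal x < b" for x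
    using inside[OF that] assms(1,3) by (simp add: continuous_on_eq_continuous_at)
  ultimately have "\<exists>F. \<forall>x. a < ereal x \<longrightarrow> ereal x < b \<longrightarrow> (F has_vector_derivative f x) (at x)"
    by (rule einterval_antiderivative)
  then show ?thesis
    using bounds by (auto simp: has_real_derivative_iff_has_vector_derivative)
qed simp

text \<open>The vector \<open>(a, b)\<close> rotates with angular speed \<tau>, as does
  \<open>(cos \<Theta>, - sin \<Theta>)\<close> when \<Theta> is an antiderivative of -\<tau>. Their
  inner product is therefore constant, and agreement at one point propagates to all of
  \<open>I\<close>.\<close>

lemma unit_vector_angle:
  fixes a b \<tau> :: "real \<Rightarrow> real"
  assumes "open I" "is_interval I" "continuous_on I \<tau>"
    and unit: "\<And>x. x \<in> I \<Longrightarrow> (a x)\<^sup>2 + (b x)\<^sup>2 = 1"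
    and a: "\<And>x. x \<in> I \<Longrightarrow> (a has_real_derivative - \<tau> x * b x) (at x)"
    and b: "\<And>x. x \<in> I \<Longrightarrow> (b has_real_derivative \<tau> x * a x) (at x)"
  obtains \<Theta> where "\<And>x. x \<in> I \<Longrightarrow> (\<Theta> has_real_derivative - \<tau> x) (at x)"
    and "\<And>x. x \<in> I \<Longrightarrow> a x = cos (\<Theta> x)" and "\<And>x. x \<in> I \<Longrightarrow> b x = - sin (\<Theta> x)"
proof (cases "I = {}")
  case False
  then obtain x0 where x0: "x0 \<in> I"
    by blast
  have "continuous_on I (\<lambda>x. - \<tau> x)"
    using assms(3) by (intro continuous_intros)
  then obtain F where F: "\<forall>x\<in>I. (F has_real_derivative - \<tau> x) (at x)"
    using continuous_on_open_interval_antiderivative assms(1,2) by blast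
  \<comment> \<open>The constant of integration: \<theta> is the angle of \<open>(a, - b)\<close> at
    the base point, so that \<Theta> takes the value \<theta> there.\<close>
  obtain \<theta> where \<theta>: "a x0 = cos \<theta>" "- b x0 = sin \<theta>"
    using sincos_total_2pi[of "a x0" "- b x0"] unit[OF x0] by auto
  define \<Theta> where "\<Theta> x = F x - F x0 + \<theta>" for x
  have \<Theta>: "(\<Theta> has_real_derivative - \<tau> x) (at x)" if "x \<in> I" for x
    unfolding \<Theta>_def using F that by (auto intro!: derivative_eq_intros)
  \<comment> \<open>The inner product of \<open>(a, b)\<close> with
    \<open>(cos \<Theta>, - sin \<Theta>)\<close>, that is, the real part of
    \<open>(a + i b) exp (i \<Theta>)\<close>.\<close>
  define p where "p x = a x * cos (\<Theta> x) - b x * sin (\<Theta> x)" for x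
  have "(p has_real_derivative 0) (at x)" if "x \<in> I" for x
    unfolding p_def
    by (rule derivative_eq_intros a[OF that] b[OF that] \<Theta>[OF that] refl
          | simp add: algebra_simps)+
  moreover have "convex I"
    using assms(2) by (simp add: is_interval_convex_1)
  ultimately obtain c where "\<And>x. x \<in> I \<Longrightarrow> p x = c"
    using has_field_derivative_zero_constant[of I p] by (metis DERIV_subset subset_UNIV)
  moreover have "p x0 = 1"
    using \<theta> unit[OF x0] by (simp add: p_def \<Theta>_def power2_eq_square flip: \<theta>)
  ultimately have p: "p x = 1" if "x \<in> I" for x
    using that x0 by metis
  (* For unit vectors, \<bar>v - w\<bar>^2 = 2 - 2 v \<bullet> w, so inner product 1 forces equality. *)
  have "(a x - cos (\<Theta> x))\<^sup>2 + (b x + sin (\<Theta> x))\<^sup>2 = 0" if "x \<in> I" for x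
    using p[OF that] unit[OF that] sin_cos_squared_add[of "\<Theta> x"]
    unfolding p_def power2_eq_square by (simp add: algebra_simps)
  then have "a x = cos (\<Theta> x) \<and> b x = - sin (\<Theta> x)" if "x \<in> I" for x
    using that by (simp add: sum_power2_eq_zero_iff eq_neg_iff_add_eq_0)
  then show ?thesis
    using that \<Theta> by blast
qed (use that in auto)

text \<open>Indefinite integrals become existentially quantified antiderivatives, because their
  constants of integration depend on \<gamma>. The choice of normal may give \<open>m\<close> either
  sign; for positive \<open>m\<close> the factors \<open>sgn m\<close> disappear.\<close>

theorem corollary8:
  fixes M :: "(real^3) set" and I :: "real set" and \<gamma> n :: "real \<Rightarrow> real^3"
    and \<kappa>\<^sub>g \<kappa>\<^sub>n \<tau>\<^sub>g :: "real \<Rightarrow> real"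
  assumes "surface M"
    and "unit_speed_curve I \<gamma>"
    and "\<gamma> ` I \<subseteq> M"
    and "unit_normal_along M I \<gamma> n"
    and "darboux_formulas I \<gamma> n \<kappa>\<^sub>g \<kappa>\<^sub>n \<tau>\<^sub>g"
    and geodesic: "\<forall>x\<in>I. \<kappa>\<^sub>g x = 0"
    and "salkowski I \<gamma>"
  shows "\<exists>(m::real) (\<Theta> :: real \<Rightarrow> real) (C :: real \<Rightarrow> real) (S :: real \<Rightarrow> real).
    (\<forall>x\<in>I. \<kappa>\<^sub>n x = m) \<and>
    (\<forall>x\<in>I. (\<Theta> has_real_derivative - \<tau>\<^sub>g x) (at x)) \<and>
    (\<forall>x\<in>I. (C has_real_derivative cos (\<Theta> x)) (at x)) \<and>
    (\<forall>x\<in>I. (S has_real_derivative sin (\<Theta> x)) (at x)) \<and>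
    (\<forall>x\<in>I.
       smarandache_TN \<gamma> x =
         vector [1, m * C x + sgn m * cos (\<Theta> x), - m * S x - sgn m * sin (\<Theta> x)] \<and>
       smarandache_TB \<gamma> x =
         vector [1, m * C x + sgn m * sin (\<Theta> x), - m * S x + sgn m * cos (\<Theta> x)] \<and>
       smarandache_TNB \<gamma> x =
         vector [1, m * C x + sgn m * (cos (\<Theta> x) + sin (\<Theta> x)),
                    - m * S x + sgn m * (cos (\<Theta> x) - sin (\<Theta> x))])"
proof -
  have I: "open I" "is_interval I" "I \<noteq> {}"
    and \<gamma>1: "\<And>x. x \<in> I \<Longrightarrow> \<gamma> x $ 1 = x"
    and diff: "\<And>k x. k < 3 \<Longrightarrow> x \<in> I \<Longrightarrow> (curve_deriv ^^ k) \<gamma> differentiable at x"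
    and cont3: "continuous_on I ((curve_deriv ^^ 3) \<gamma>)"
    and \<kappa>_pos: "\<And>x. x \<in> I \<Longrightarrow> curvature \<gamma> x > 0"
    using assms(2) unfolding unit_speed_curve_def by auto
  note n = unit_normal_isotropic_unit[OF assms(4)]
  define \<gamma>'' where "\<gamma>'' = (curve_deriv ^^ 2) \<gamma>"
  have \<gamma>''_eq: "\<gamma>'' = curve_deriv (tangent \<gamma>)"
    by (simp add: \<gamma>''_def numeral_2_eq_2 tangent_def[abs_def])
  have \<gamma>'''_eq: "(curve_deriv ^^ 3) \<gamma> = curve_deriv \<gamma>''"
    by (simp add: \<gamma>''_def numeral_3_eq_3 numeral_2_eq_2)
  have T': "(tangent \<gamma> has_vector_derivative \<kappa>\<^sub>n x *\<^sub>R n x) (at x)"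
    and n': "(n has_vector_derivative - \<tau>\<^sub>g x *\<^sub>R darboux_Q \<gamma> n x) (at x)" if "x \<in> I" for x
    using assms(5) geodesic that unfolding darboux_formulas_def by auto
  have \<gamma>'': "\<gamma>'' x = \<kappa>\<^sub>n x *\<^sub>R n x" if "x \<in> I" for x
    using T'[OF that] unfolding \<gamma>''_eq curve_deriv_def by (rule vector_derivative_at)
  have T1: "tangent \<gamma> x $ 1 = 1" if x: "x \<in> I" for x
  proof -
    have "\<gamma> differentiable at x"
      using diff[of 0 x] x by simp
    then have "((\<lambda>t. \<gamma> t $ 1) has_real_derivative tangent \<gamma> x $ 1) (at x)"
      unfolding tangent_def curve_deriv_def
      by (intro has_vector_derivative_vec_nth) (simp add: vector_derivative_works)
    then have "((\<lambda>t. t) has_real_derivative tangent \<gamma> x $ 1) (at x)"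
      by (rule has_field_derivative_transform_within_open[OF _ I(1) x]) (simp add: \<gamma>1)
    then show ?thesis
      using DERIV_ident DERIV_unique by blast
  qed
  have \<kappa>: "curvature \<gamma> x = \<bar>\<kappa>\<^sub>n x\<bar>" if "x \<in> I" for x
  proof -
    have "gnorm (n x) = 1"
      using n[OF that] by (simp add: gnorm_isotropic)
    then show ?thesis
      using \<gamma>''[OF that] n(1)[OF that]
      by (simp add: curvature_def gnorm_scaleR_isotropic flip: \<gamma>''_def)
  qed
  obtain c where c: "\<And>x. x \<in> I \<Longrightarrow> \<bar>\<kappa>\<^sub>n x\<bar> = c"
    using assms(7) \<kappa> unfolding salkowski_def constant_on_def by force
  \<comment> \<open>On isotropic vectors the Galilean and Euclidean products agree, so
    \<open>n\<close> is also a Euclidean unit vector. The formula yields continuity of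
    \<open>\<kappa>\<^sub>n\<close>, which the Darboux formulas alone do not state.\<close>
  have "\<kappa>\<^sub>n x = \<gamma>'' x \<bullet> n x" if "x \<in> I" for x
  proof -
    have "n x \<bullet> n x = 1"
      using n[OF that] by (simp add: inner_vec_def sum_3 power2_eq_square)
    then show ?thesis
      using \<gamma>''[OF that] by simp
  qed
  moreover have "continuous_on I \<gamma>''"
    using diff[of 2] by (simp add: \<gamma>''_def continuous_at_imp_continuous_on differentiable_imp_continuous_within)
  moreover have cont_n: "continuous_on I n"
    using assms(4) by (simp add: unit_normal_along_def)
  ultimately have "continuous_on I \<kappa>\<^sub>n"
    by (metis (no_types, lifting) continuous_on_cong continuous_on_inner)
  then obtain m where m: "\<And>x. x \<in> I \<Longrightarrow> \<kappa>\<^sub>n x = m"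
    using continuous_on_abs_const_imp_constant[of I \<kappa>\<^sub>n c] c I(2)
    unfolding constant_on_def is_interval_connected_1 by metis
  have m0: "m \<noteq> 0"
    using \<kappa>_pos \<kappa> m I(3) by force
  \<comment> \<open>Since \<open>T\<close> has first component 1, \<open>Q\<close> is
    \<open>n\<close> turned by a quarter turn in the isotropic plane.\<close>
  have Q: "darboux_Q \<gamma> n x $ 1 = 0" "darboux_Q \<gamma> n x $ 2 = n x $ 3"
    "darboux_Q \<gamma> n x $ 3 = - n x $ 2" if "x \<in> I" for x
    using that n T1 by (simp_all add: darboux_Q_def)

  define \<gamma>''' where "\<gamma>''' = (curve_deriv ^^ 3) \<gamma>"
  have \<gamma>''': "\<gamma>''' x = m *\<^sub>R (- \<tau>\<^sub>g x *\<^sub>R darboux_Q \<gamma> n x)" if x: "x \<in> I" for x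
  proof -
    have "((\<lambda>t. m *\<^sub>R n t) has_vector_derivative m *\<^sub>R (- \<tau>\<^sub>g x *\<^sub>R darboux_Q \<gamma> n x)) (at x)"
      using n'[OF x] by (rule bounded_linear.has_vector_derivative[OF bounded_linear_scaleR_right])
    then have "(\<gamma>'' has_vector_derivative m *\<^sub>R (- \<tau>\<^sub>g x *\<^sub>R darboux_Q \<gamma> n x)) (at x)"
      by (rule has_vector_derivative_transform_within_open[OF _ I(1) x]) (simp add: \<gamma>'' m)
    then show ?thesis
      unfolding \<gamma>'''_def \<gamma>'''_eq curve_deriv_def by (rule vector_derivative_at)
  qed
  \<comment> \<open>The planar determinant of \<open>n\<close> and \<open>Q\<close> is -1, so
    pairing \<open>n\<close> with \<open>\<gamma>'''\<close> isolates the geodesic torsion. Its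
    continuity then follows from the continuity of \<open>\<gamma>'''\<close> and
    \<open>n\<close>.\<close>
  have \<tau>: "\<tau>\<^sub>g x = (n x $ 2 * \<gamma>''' x $ 3 - n x $ 3 * \<gamma>''' x $ 2) / m" if "x \<in> I" for x
  proof -
    have "n x $ 2 * \<gamma>''' x $ 3 - n x $ 3 * \<gamma>''' x $ 2 = m * \<tau>\<^sub>g x * ((n x $ 2)\<^sup>2 + (n x $ 3)\<^sup>2)"
      using that by (simp add: \<gamma>''' Q power2_eq_square algebra_simps)
    then show ?thesis
      using n(2)[OF that] m0 by simp
  qed
  have "continuous_on I (\<lambda>x. (n x $ 2 * \<gamma>''' x $ 3 - n x $ 3 * \<gamma>''' x $ 2) / m)"
    using cont_n cont3 m0 unfolding \<gamma>'''_def by (intro continuous_intros) auto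
  then have "continuous_on I \<tau>\<^sub>g"
    using \<tau> by (simp cong: continuous_on_cong)
  moreover have "((\<lambda>x. n x $ 2) has_real_derivative - \<tau>\<^sub>g x * n x $ 3) (at x)"
    "((\<lambda>x. n x $ 3) has_real_derivative \<tau>\<^sub>g x * n x $ 2) (at x)" if "x \<in> I" for x
    using has_vector_derivative_vec_nth[OF n'[OF that], of 2]
      has_vector_derivative_vec_nth[OF n'[OF that], of 3] Q[OF that] by simp_all
  ultimately obtain \<Theta> where \<Theta>: "\<And>x. x \<in> I \<Longrightarrow> (\<Theta> has_real_derivative - \<tau>\<^sub>g x) (at x)"
    and n2: "\<And>x. x \<in> I \<Longrightarrow> n x $ 2 = cos (\<Theta> x)" and n3: "\<And>x. x \<in> I \<Longrightarrow> n x $ 3 = - sin (\<Theta> x)"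
    using unit_vector_angle[OF I(1,2), of \<tau>\<^sub>g "\<lambda>x. n x $ 2" "\<lambda>x. n x $ 3"] n(2) by metis

  \<comment> \<open>Taking the antiderivatives from \<open>T\<close> itself fixes their constants of
    integration, so that \<open>T\<close> equals \<open>(1, m C, - m S)\<close> with no additive
    constants left over.\<close>
  define C S where "C x = tangent \<gamma> x $ 2 / m" and "S x = - (tangent \<gamma> x $ 3) / m" for x
  have C: "(C has_real_derivative cos (\<Theta> x)) (at x)"
    and S: "(S has_real_derivative sin (\<Theta> x)) (at x)" if x: "x \<in> I" for x
  proof -
    note T'_nth = has_vector_derivative_vec_nth[OF T'[OF x]]
    show "(C has_real_derivative cos (\<Theta> x)) (at x)"
      using DERIV_cdivide[OF T'_nth[of 2], of m] m0 x
      by (simp add: C_def[abs_def] m n2)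
    show "(S has_real_derivative sin (\<Theta> x)) (at x)"
      using DERIV_cdivide[OF DERIV_minus[OF T'_nth[of 3]], of m] m0 x
      by (simp add: S_def[abs_def] m n3)
  qed
  have T: "tangent \<gamma> x = vector [1, m * C x, - m * S x]" if "x \<in> I" for x
    using m0 T1[OF that] by (simp add: vec3_eq_iff C_def S_def)
  \<comment> \<open>Here \<open>sgn m\<close> enters: dividing \<open>m n\<close> by the curvature,
    which is the absolute value of \<open>m\<close>, leaves \<open>sgn m\<close> times
    \<open>n\<close>.\<close>
  have N: "principal_normal \<gamma> x = vector [0, sgn m * cos (\<Theta> x), - sgn m * sin (\<Theta> x)]"
    if "x \<in> I" for x
    using \<gamma>''[OF that] n(1)[OF that] n2[OF that] n3[OF that] \<kappa>[OF that] m[OF that]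
    by (simp add: vec3_eq_iff principal_normal_def real_sgn_eq flip: \<gamma>''_def)
  have B: "binormal \<gamma> x = vector [0, sgn m * sin (\<Theta> x), sgn m * cos (\<Theta> x)]" if "x \<in> I" for x
    using T[OF that] N[OF that] by (simp add: vec3_eq_iff binormal_def)
  have "smarandache_TN \<gamma> x =
      vector [1, m * C x + sgn m * cos (\<Theta> x), - m * S x - sgn m * sin (\<Theta> x)] \<and>
    smarandache_TB \<gamma> x =
      vector [1, m * C x + sgn m * sin (\<Theta> x), - m * S x + sgn m * cos (\<Theta> x)] \<and>
    smarandache_TNB \<gamma> x =
      vector [1, m * C x + sgn m * (cos (\<Theta> x) + sin (\<Theta> x)),
                 - m * S x + sgn m * (cos (\<Theta> x) - sin (\<Theta> x))]" if "x \<in> I" for x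
    using T[OF that] N[OF that] B[OF that]
    by (simp add: vec3_eq_iff smarandache_TN_def smarandache_TB_def smarandache_TNB_def algebra_simps)
  then show ?thesis
    using m \<Theta> C S by blast
qed

end
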